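(* Let $g\in\mathbb{R}^n\setminus\{0\}$, let $H$ be a real symmetric $n\times n$ matrix, and let $\rho:\mathbb{R}\to[0,\infty]$ be a proper closed convex function with $\rho(0)=0$. Suppose that: (1) $\rho$ is nondecreasing, $\rho(t)=0$ for all $t\le 0$, and there exists $t_0>0$ with $\rho(t_0)<\infty$; (2) $\lim_{t\to\infty}\rho(t)/t=\infty$; (3) the monotone conjugate $\rho^+$ is differentiable at every $t>0$. Consider the problem $$(\mathrm{P})\qquad \inf_{x\in\mathbb{R}^n}\ 2g^Tx+x^THx+\rho(\|x\|^2).$$ (i) Suppose that $H\succ 0$. If $\|H^{-1}g\|^2\in\operatorname{arg\,min}\rho$, then $x^*=-H^{-1}g$ solves (P). Otherwise, there exists a unique $\lambda^*<0$ such that $\|(H-\lambda^*I)^{-1}g\|^2=(\rho^+)'(-\lambda^* )$, and $x^*=-(H-\lambda^*I)^{-1}g$ solves (P). (ii) Suppose that $\lambda_{\min}(H)\le 0$ and $g\in{\rm Range}(H-\lambda_{\min}(H)I)$. Then $\lambda\mapsto(H-\lambda I)^\dagger g$ is continuous on $(-\infty,\lambda_{\min}(H)]$. If $\|(H-\lambda_{\min}(H)I)^\dagger g\|>\sqrt{(\rho^+)'_+(-\lambda_{\min}(H))}$, then there exists a unique $\lambda^*<\lambda_{\min}(H)$ such that $\|(H-\lambda^*I)^{-1}g\|^2=(\rho^+)'(-\lambda^* )$, and $x^*=-(H-\lambda^*I)^{-1}g$ solves (P). On the other hand, if $\|(H-\lambda_{\min}(H)I)^\dagger g\|\le\sqrt{(\rho^+)'_+(-\lambda_{\min}(H))}$,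 then a solution of (P) is given by $$x^*=-(H-\lambda_{\min}(H)I)^\dagger g+\alpha^*v^*$$ for some $\alpha^*\in\mathbb{R}$ and $v^*\in\ker(H-\lambda_{\min}(H)I)\setminus\{0\}$ satisfying $$(\rho^+)'_+(-\lambda_{\min}(H))=\|(H-\lambda_{\min}(H)I)^\dagger g-\alpha^*v^*\|^2.$$
   Context: $\|\cdot\|$ is the Euclidean norm, $I$ the identity matrix, $A^\dagger$ the Moore-Penrose pseudoinverse, $\lambda_{\min}(A)$ the smallest eigenvalue of a symmetric matrix $A$, and $A\succ 0$ means positive definite. The monotone conjugate of $\rho$ is $\rho^+(u):=\sup_{t\ge 0}\{ut-\rho(t)\}$; under (2) it is finite everywhere. $f'_+$ denotes the right-hand derivative of $f$. "$x^*$ solves (P)" means that $x^*$ is a global minimizer. *)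

theory Defs
  imports "HOL-Analysis.Analysis"
begin

text \<open>
  Closedness (lower semicontinuity) and convexity are stated through the epigraph; the library's
  \<open>epigraph\<close> and \<open>convex_on\<close> only cover functions with finite values.
\<close>
definition proper_closed_convex :: "(real \<Rightarrow> ereal) \<Rightarrow> bool" where
  "proper_closed_convex f \<longleftrightarrow>
     (\<forall>t. f t \<noteq> - \<infinity>) \<and> (\<exists>t. f t \<noteq> \<infinity>) \<and>
     closed {(t, s::real). f t \<le> ereal s} \<and> convex {(t, s::real). f t \<le> ereal s}"

definition argmin :: "('a \<Rightarrow> ereal) \<Rightarrow> 'a set" where
  "argmin f = {x. \<forall>y. f x \<le> f y}"

definition mono_conj_ereal :: "(real \<Rightarrow> ereal) \<Rightarrow> real \<Rightarrow> ereal" where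
  "mono_conj_ereal f u = (SUP t\<in>{0..}. ereal (u * t) - f t)"

text \<open>
  The real-valued version, used for taking derivatives.  The conversion loses nothing for the
  superlinear functions considered here, see \<open>mono_conj_finite\<close> below.
\<close>
definition mono_conj :: "(real \<Rightarrow> ereal) \<Rightarrow> real \<Rightarrow> real" where
  "mono_conj f u = real_of_ereal (mono_conj_ereal f u)"

lemma mono_conj_finite:
  fixes f :: "real \<Rightarrow> ereal"
  assumes nonneg: "\<And>t. 0 \<le> f t" and zero: "f 0 = 0"
    and superlinear: "((\<lambda>t. f t / ereal t) \<longlongrightarrow> \<infinity>) at_top"
  shows "ereal (mono_conj f u) = mono_conj_ereal f u"
proof -
  have "eventually (\<lambda>t. ereal u < f t / ereal t) at_top"
    using superlinear by (rule order_tendstoD) simp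
  then obtain T where T: "\<And>t. t \<ge> T \<Longrightarrow> ereal u < f t / ereal t"
    by (auto simp: eventually_at_top_linorder)
  define B where "B = \<bar>u\<bar> * max T 1"
  have B0: "0 \<le> B"
    by (simp add: B_def)
  have upper: "ereal (u * t) - f t \<le> ereal B" if "t \<ge> 0" for t
  proof (cases "f t")
    case (real r)
    have r0: "0 \<le> r"
      using nonneg[of t] real by simp
    show ?thesis
    proof (cases "t \<ge> max T 1")
      case True
      then have "u < r / t"
        using T[of t] real by simp
      with True have "u * t \<le> r"
        by (simp add: field_simps)
      then show ?thesis
        using B0 real by simp
    next
      case False
      have "u * t \<le> \<bar>u\<bar> * t"
        using that by (intro mult_right_mono) auto
      also have "\<dots> \<le> B"
        unfolding B_def using False by (intro mult_left_mono) auto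
      finally show ?thesis
        using r0 real by simp
    qed
  qed (use nonneg[of t] in auto)
  have "mono_conj_ereal f u \<le> ereal B"
    unfolding mono_conj_ereal_def using upper by (auto intro!: SUP_least)
  moreover have "ereal (u * 0) - f 0 \<le> mono_conj_ereal f u"
    unfolding mono_conj_ereal_def by (rule SUP_upper) simp
  ultimately have "\<bar>mono_conj_ereal f u\<bar> \<noteq> \<infinity>"
    using zero by auto
  then show ?thesis
    by (simp add: mono_conj_def ereal_real)
qed

definition right_deriv :: "(real \<Rightarrow> real) \<Rightarrow> real \<Rightarrow> real" where
  "right_deriv f x = (THE D. (f has_real_derivative D) (at_right x))"

definition symmetric_matrix :: "real^'n^'n \<Rightarrow> bool" where
  "symmetric_matrix A \<longleftrightarrow> transpose A = A"

definition positive_definite :: "real^'n^'n \<Rightarrow> bool" where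
  "positive_definite A \<longleftrightarrow> symmetric_matrix A \<and> (\<forall>x. x \<noteq> 0 \<longrightarrow> 0 < x \<bullet> (A *v x))"

definition eigenvalues :: "real^'n^'n \<Rightarrow> real set" where
  "eigenvalues A = {l. \<exists>v. v \<noteq> 0 \<and> A *v v = l *\<^sub>R v}"

text \<open>
  Only meaningful for symmetric matrices, where the set of real eigenvalues is finite and nonempty.
\<close>
definition lambda_min :: "real^'n^'n \<Rightarrow> real" where
  "lambda_min A = Min (eigenvalues A)"

text \<open>
  The four Penrose conditions, which determine the pseudoinverse of a real matrix uniquely.
\<close>
definition is_pinv :: "real^'n^'m \<Rightarrow> real^'m^'n \<Rightarrow> bool" where
  "is_pinv A B \<longleftrightarrow>
     A ** B ** A = A \<and> B ** A ** B = B \<and>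
     transpose (A ** B) = A ** B \<and> transpose (B ** A) = B ** A"

definition pinv :: "real^'n^'m \<Rightarrow> real^'m^'n" where
  "pinv A = (THE B. is_pinv A B)"

definition mat_range :: "real^'n^'m \<Rightarrow> (real^'m) set" where
  "mat_range A = range (\<lambda>x. A *v x)"

definition mat_ker :: "real^'n^'m \<Rightarrow> (real^'n) set" where
  "mat_ker A = {x. A *v x = 0}"

definition shifted :: "real^'n^'n \<Rightarrow> real \<Rightarrow> real^'n^'n" where
  "shifted H l = H - l *\<^sub>R mat 1"

definition objective :: "real^'n \<Rightarrow> real^'n^'n \<Rightarrow> (real \<Rightarrow> ereal) \<Rightarrow> real^'n \<Rightarrow> ereal" where
  "objective g H f x = ereal (2 * (g \<bullet> x) + x \<bullet> (H *v x)) + f ((norm x)\<^sup>2)"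

definition solves_P :: "real^'n \<Rightarrow> real^'n^'n \<Rightarrow> (real \<Rightarrow> ereal) \<Rightarrow> real^'n \<Rightarrow> bool" where
  "solves_P g H f x \<longleftrightarrow> x \<in> argmin (objective g H f)"

end

theory Submission
  imports Defs
begin

text \<open>
  If \<open>\<lambda> \<le> 0\<close>, \<open>H - \<lambda>I\<close> is positive semidefinite, \<open>(H - \<lambda>I)x = -g\<close> and \<open>\<parallel>x\<parallel>\<^sup>2\<close> maximizes
  \<open>t \<mapsto> -\<lambda>t - \<rho>(t)\<close> over \<open>t \<ge> 0\<close>, then adding the two minimization inequalities shows that \<open>x\<close>
  is a global minimizer. The maximizers are subgradients of the monotone conjugate, so for
  \<open>-\<lambda> > 0\<close> the unique maximizer is its derivative and for \<open>\<lambda> = 0\<close> the greatest one is its right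
  derivative. It remains to solve the scalar equation
  \<open>\<parallel>(H - \<lambda>I)\<^sup>-\<^sup>1g\<parallel>\<^sup>2 = (\<rho>\<^sup>+)'(-\<lambda>)\<close>, which the intermediate value theorem does. In the degenerate case
  one replaces \<open>H\<close> by \<open>H + P\<close>, where \<open>P\<close> is the orthogonal projection onto
  \<open>ker(H - \<lambda>\<^sub>m\<^sub>i\<^sub>nI)\<close>: for \<open>g\<close> in the range this leaves the solution orthogonal to the kernel
  unchanged, while \<open>H + P - \<lambda>I\<close> stays positive definite up to and including \<open>\<lambda>\<^sub>m\<^sub>i\<^sub>n\<close>. If the
  equation has no solution, a kernel vector supplies the missing norm.
\<close>

subsection \<open>Symmetric matrices and the pseudoinverse\<close>

lemma symmetric_matrix_inner:
  fixes A :: "real^'n^'n"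
  assumes "symmetric_matrix A"
  shows "x \<bullet> (A *v y) = (A *v x) \<bullet> y"
  using assms dot_lmul_matrix[of x A y] transpose_matrix_vector[of A x]
  by (simp add: symmetric_matrix_def)

lemma symmetric_matrixI:
  fixes A :: "real^'n^'n"
  assumes "\<And>x y. x \<bullet> (A *v y) = (A *v x) \<bullet> y"
  shows "symmetric_matrix A"
proof -
  have "transpose A *v x = A *v x" for x
  proof -
    have "(transpose A *v x - A *v x) \<bullet> y = 0" for y
      using assms[of x y] dot_lmul_matrix[of x A y] by (simp add: inner_diff_left)
    then show ?thesis
      using inner_eq_zero_iff by fastforce
  qed
  then show ?thesis
    by (simp add: symmetric_matrix_def matrix_eq)
qed

lemma shifted_vmult: "shifted H l *v x = H *v x - l *\<^sub>R x"
  by (simp add: shifted_def matrix_vector_mult_diff_rdistrib scaleR_matrix_vector_assoc[symmetric])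

lemma symmetric_matrix_shifted:
  assumes "symmetric_matrix H"
  shows "symmetric_matrix (shifted H l)"
  by (rule symmetric_matrixI)
    (simp add: shifted_vmult inner_diff symmetric_matrix_inner[OF assms])

text \<open>At a zero \<open>v\<close> of a nonnegative form, moving against
  \<open>w = A *v v\<close> would make the form negative to first order unless
  \<open>w = 0\<close>.\<close>

lemma psd_kernel:
  fixes A :: "real^'n^'n"
  assumes sym: "symmetric_matrix A" and psd: "\<And>x. 0 \<le> x \<bullet> (A *v x)"
    and v: "v \<bullet> (A *v v) = 0"
  shows "A *v v = 0"
proof (rule ccontr)
  define w where "w = A *v v"
  define c where "c = w \<bullet> (A *v w)"
  define a where "a = w \<bullet> w"
  assume "A *v v \<noteq> 0"
  then have a: "a > 0"
    by (simp add: a_def w_def)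
  have c: "c \<ge> 0"
    using psd by (simp add: c_def)
  \<comment> \<open>The form at \<open>v - t *\<^sub>R w\<close> is
    \<open>t * (t * c - 2 * a)\<close>, negative for small positive \<open>t\<close>; the
    \<open>+ 1\<close> covers \<open>c = 0\<close>.\<close>
  define t where "t = a / (c + 1)"
  have t: "t > 0" "t * c < a"
    using a c by (simp_all add: t_def field_simps)
  have "v \<bullet> (A *v w) = a"
    by (simp add: symmetric_matrix_inner[OF sym] a_def w_def)
  then have "(v - t *\<^sub>R w) \<bullet> (A *v (v - t *\<^sub>R w)) = t * (t * c - 2 * a)"
    using v by (simp add: matrix_vector_mult_diff_distrib matrix_vector_mult_scaleR inner_diff
        flip: w_def) (simp add: a_def c_def algebra_simps)
  moreover have "t * (t * c - 2 * a) < 0"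
    using t a by (intro mult_pos_neg) auto
  ultimately show False
    using psd[of "v - t *\<^sub>R w"] by simp
qed

text \<open>Minimizing the form over the unit sphere gives \<open>\<mu>\<close> and
  \<open>v\<close>. The form of \<open>shifted H \<mu>\<close> is then nonnegative and vanishes at
  \<open>v\<close>, so \<open>psd_kernel\<close> yields the eigenvector equation without Lagrange
  multipliers.\<close>

lemma rayleigh_minimum:
  fixes H :: "real^'n^'n"
  assumes sym: "symmetric_matrix H"
  obtains \<mu> v where "norm v = 1" "H *v v = \<mu> *\<^sub>R v" "\<And>x. \<mu> * (norm x)\<^sup>2 \<le> x \<bullet> (H *v x)"
proof -
  have "compact (sphere (0::real^'n) 1)" "sphere (0::real^'n) 1 \<noteq> {}"
    by simp_all
  moreover have "continuous_on (sphere 0 1) (\<lambda>x. x \<bullet> (H *v x))"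
    by (intro continuous_intros matrix_vector_mult_linear_continuous_on)
  ultimately obtain v where v: "norm v = 1"
    and min: "\<And>y. norm y = 1 \<Longrightarrow> v \<bullet> (H *v v) \<le> y \<bullet> (H *v y)"
    using continuous_attains_inf[of "sphere 0 1" "\<lambda>x. x \<bullet> (H *v x)"] by (auto simp: dist_norm)
  define \<mu> where "\<mu> = v \<bullet> (H *v v)"
  have *: "\<mu> * (norm x)\<^sup>2 \<le> x \<bullet> (H *v x)" for x
  proof (cases "x = 0")
    case False
    have "\<mu> \<le> (x /\<^sub>R norm x) \<bullet> (H *v (x /\<^sub>R norm x))"
      unfolding \<mu>_def using False by (intro min) simp
    also have "\<dots> = x \<bullet> (H *v x) / (norm x)\<^sup>2"
      by (simp add: matrix_vector_mult_scaleR power2_eq_square field_simps)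
    finally show ?thesis
      using False by (simp add: field_simps)
  qed simp
  have "shifted H \<mu> *v v = 0"
  proof (rule psd_kernel[OF symmetric_matrix_shifted[OF sym]])
    show "0 \<le> x \<bullet> (shifted H \<mu> *v x)" for x
      using *[of x] by (simp add: shifted_vmult inner_diff power2_norm_eq_inner)
    show "v \<bullet> (shifted H \<mu> *v v) = 0"
      using v by (simp add: shifted_vmult inner_diff \<mu>_def flip: power2_norm_eq_inner)
  qed
  then show ?thesis
    using that[OF v _ *] by (simp add: shifted_vmult)
qed

text \<open>Eigenvectors for distinct eigenvalues are orthogonal, hence independent. Finiteness
  gives the \<open>Min\<close> in \<open>lambda_min\<close> its meaning.\<close>

lemma finite_eigenvalues:
  fixes H :: "real^'n^'n"
  assumes sym: "symmetric_matrix H"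
  shows "finite (eigenvalues H)"
proof -
  define f where "f l = (SOME v. v \<noteq> 0 \<and> H *v v = l *\<^sub>R v)" for l
  have f: "f l \<noteq> 0 \<and> H *v f l = l *\<^sub>R f l" if "l \<in> eigenvalues H" for l
    unfolding f_def by (rule someI_ex) (use that in \<open>simp add: eigenvalues_def\<close>)
  have orth: "orthogonal (f l) (f m)"
    if "l \<in> eigenvalues H" "m \<in> eigenvalues H" "l \<noteq> m" for l m
  proof -
    have "m * (f l \<bullet> f m) = l * (f l \<bullet> f m)"
      using symmetric_matrix_inner[OF sym, of "f l" "f m"] f[OF that(1)] f[OF that(2)] by simp
    then show ?thesis
      using that by (simp add: orthogonal_def)
  qed
  have "inj_on f (eigenvalues H)"
    by (rule inj_onI) (metis orth f orthogonal_self)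
  moreover have "independent (f ` eigenvalues H)"
  proof (rule pairwise_orthogonal_independent)
    show "pairwise orthogonal (f ` eigenvalues H)"
      unfolding pairwise_def using orth by fastforce
    show "0 \<notin> f ` eigenvalues H"
      using f by force
  qed
  ultimately show ?thesis
    using finite_imageD independent_imp_finite by blast
qed

text \<open>Every eigenvalue is the Rayleigh quotient of its eigenvector, so the minimum of the
  quotient, itself an eigenvalue, is the least one.\<close>

lemma lambda_min_properties:
  fixes H :: "real^'n^'n"
  assumes sym: "symmetric_matrix H"
  shows lambda_min_eigenvalue: "lambda_min H \<in> eigenvalues H"
    and lambda_min_le: "\<And>x. lambda_min H * (norm x)\<^sup>2 \<le> x \<bullet> (H *v x)"
proof -
  obtain \<mu> v where v: "norm v = 1" "H *v v = \<mu> *\<^sub>R v"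
    and \<mu>: "\<And>x. \<mu> * (norm x)\<^sup>2 \<le> x \<bullet> (H *v x)"
    using rayleigh_minimum[OF sym] by metis
  have mem: "\<mu> \<in> eigenvalues H"
    using v unfolding eigenvalues_def by (auto intro!: exI[of _ v])
  have "\<mu> \<le> l" if l: "l \<in> eigenvalues H" for l
  proof -
    obtain w where w: "w \<noteq> 0" "H *v w = l *\<^sub>R w"
      using l by (auto simp: eigenvalues_def)
    then have "\<mu> * (norm w)\<^sup>2 \<le> l * (norm w)\<^sup>2"
      using \<mu>[of w] by (simp add: power2_norm_eq_inner)
    then show ?thesis
      using w by simp
  qed
  then have eq: "lambda_min H = \<mu>"
    unfolding lambda_min_def by (intro Min_eqI finite_eigenvalues[OF sym] mem)
  show "lambda_min H \<in> eigenvalues H"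
    using eq mem by simp
  show "\<And>x. lambda_min H * (norm x)\<^sup>2 \<le> x \<bullet> (H *v x)"
    using \<mu> eq by simp
qed

section \<open>Inverses, the Penrose conditions and orthogonal projections\<close>

lemma invertible_matrix_inv:
  fixes A :: "real^'n^'n"
  assumes "invertible A"
  shows matrix_inv_mult_right: "A ** matrix_inv A = mat 1"
    and matrix_inv_mult_left: "matrix_inv A ** A = mat 1"
proof -
  have "A ** matrix_inv A = mat 1 \<and> matrix_inv A ** A = mat 1"
    unfolding matrix_inv_def by (rule someI_ex) (use assms in \<open>simp add: invertible_def\<close>)
  then show "A ** matrix_inv A = mat 1" "matrix_inv A ** A = mat 1"
    by simp_all
qed

lemma matrix_inv_vmult_right:
  fixes A :: "real^'n^'n"
  assumes "invertible A"
  shows "A *v (matrix_inv A *v x) = x"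
  using matrix_inv_mult_right[OF assms] by (simp add: matrix_vector_mul_assoc)

lemma matrix_inv_vmult_left:
  fixes A :: "real^'n^'n"
  assumes "invertible A"
  shows "matrix_inv A *v (A *v x) = x"
  using matrix_inv_mult_left[OF assms] by (simp add: matrix_vector_mul_assoc)

lemma positive_definite_invertible:
  fixes A :: "real^'n^'n"
  assumes "positive_definite A"
  shows "invertible A"
  using assms unfolding invertible_left_inverse matrix_left_invertible_ker positive_definite_def
  by fastforce

lemma positive_definite_shifted_mono:
  fixes M :: "real^'n^'n"
  assumes "positive_definite (shifted M b)" "symmetric_matrix M" "l \<le> b"
  shows "positive_definite (shifted M l)"
  unfolding positive_definite_def
proof (intro conjI allI impI symmetric_matrix_shifted assms(2))
  fix x :: "real^'n"
  assume "x \<noteq> 0"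
  then have "0 < x \<bullet> (shifted M b *v x)"
    using assms(1) by (simp add: positive_definite_def)
  moreover have "0 \<le> (b - l) * (x \<bullet> x)"
    using assms(3) by simp
  ultimately show "0 < x \<bullet> (shifted M l *v x)"
    by (simp add: shifted_vmult inner_diff algebra_simps)
qed

text \<open>\<open>A ** B\<close> and \<open>A ** C\<close> are both the orthogonal projection onto
  the range of \<open>A\<close>, and \<open>B ** A\<close> and \<open>C ** A\<close> agree likewise;
  then \<open>B = B ** A ** B = C ** A ** C = C\<close>. So any matrix satisfying the conditions is
  the value of \<open>pinv\<close>.\<close>

lemma is_pinv_unique:
  fixes A :: "real^'n^'m"
  assumes B: "is_pinv A B" and C: "is_pinv A C"
  shows "B = C"
proof -
  have "A ** B = A ** C"
  proof -
    have "A ** B = transpose (A ** B)"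
      using B by (simp add: is_pinv_def)
    also have "\<dots> = transpose ((A ** C) ** (A ** B))"
      using C by (simp add: is_pinv_def matrix_mul_assoc)
    also have "\<dots> = (A ** B) ** (A ** C)"
      using B C by (simp add: is_pinv_def matrix_transpose_mul[of "A ** C"])
    also have "\<dots> = A ** C"
      using B by (simp add: is_pinv_def matrix_mul_assoc)
    finally show ?thesis .
  qed
  moreover have "B ** A = C ** A"
  proof -
    have "B ** A = transpose (B ** A)"
      using B by (simp add: is_pinv_def)
    also have "\<dots> = transpose ((B ** A) ** (C ** A))"
      using C by (simp add: is_pinv_def) (metis matrix_mul_assoc)
    also have "\<dots> = (C ** A) ** (B ** A)"
      using B C by (simp add: is_pinv_def matrix_transpose_mul[of "B ** A"])
    also have "\<dots> = C ** A"
      using B by (simp add: is_pinv_def) (metis matrix_mul_assoc)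
    finally show ?thesis .
  qed
  ultimately have "B ** A ** B = C ** A ** C"
    by (metis matrix_mul_assoc)
  then show ?thesis
    using B C by (simp add: is_pinv_def)
qed

lemma pinv_eqI:
  assumes "is_pinv A B"
  shows "pinv A = B"
  unfolding pinv_def using assms is_pinv_unique by blast

lemma pinv_invertible:
  fixes A :: "real^'n^'n"
  assumes "invertible A"
  shows "pinv A = matrix_inv A"
  by (rule pinv_eqI) (simp add: is_pinv_def matrix_inv_mult_left[OF assms] matrix_inv_mult_right[OF assms])

text \<open>The matrix is the sum of the rank-one projections onto an orthonormal basis of
  \<open>K\<close>. Symmetry is what makes the projection orthogonal.\<close>

lemma orthogonal_projection_matrix:
  fixes K :: "(real^'n) set"
  assumes "subspace K"
  obtains P where "symmetric_matrix P" "\<And>x. P *v x \<in> K" "\<And>k. k \<in> K \<Longrightarrow> P *v k = k"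
proof -
  obtain B where B: "B \<subseteq> K" "pairwise orthogonal B" "\<And>x. x \<in> B \<Longrightarrow> norm x = 1"
    "independent B" "span B = K"
    using orthonormal_basis_subspace[OF assms] by metis
  have fin: "finite B"
    using B(4) independent_imp_finite by blast
  define p where "p x = (\<Sum>b\<in>B. (b \<bullet> x) *\<^sub>R b)" for x
  have "linear p"
    by (rule linearI) (simp_all add: p_def inner_add algebra_simps sum.distrib scaleR_sum_right)
  then have P: "matrix p *v x = p x" for x
    by (simp add: matrix_works)
  have p_basis: "p c = c" if "c \<in> B" for c
  proof -
    have "p c = (\<Sum>b\<in>B. if b = c then c else 0)"
      unfolding p_def
    proof (rule sum.cong)
      fix b assume "b \<in> B"
      then show "(b \<bullet> c) *\<^sub>R b = (if b = c then c else 0)"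
        using B(2,3) that by (auto simp: pairwise_def orthogonal_def dot_square_norm)
    qed simp
    then show ?thesis
      using fin that by simp
  qed
  show ?thesis
  proof
    show "symmetric_matrix (matrix p)"
      by (rule symmetric_matrixI)
        (simp add: P p_def inner_sum_left inner_sum_right inner_commute mult.commute)
    show "matrix p *v x \<in> K" for x
      unfolding P p_def using B(1) assms by (intro subspace_sum subspace_scale) auto
    show "matrix p *v k = k" if "k \<in> K" for k
    proof -
      have "p k = id k"
        using linear_eq_on_span[OF \<open>linear p\<close> linear_id, of B k] p_basis that B(5) by auto
      then show ?thesis
        by (simp add: P)
    qed
  qed
qed

lemma subspace_mat_ker: "subspace (mat_ker A)"
  by (auto simp: subspace_def mat_ker_def algebra_simps)

subsection \<open>Maximizers of the monotone conjugate\<close>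

locale superlinear_penalty =
  fixes \<rho> :: "real \<Rightarrow> ereal"
  assumes nonneg: "\<And>t. 0 \<le> \<rho> t"
    and zero: "\<rho> 0 = 0"
    and mono: "mono \<rho>"
    and closed_epi: "closed {(t, s::real). \<rho> t \<le> ereal s}"
    and nontrivial: "\<exists>t0>0. \<rho> t0 < \<infinity>"
    and superlinear: "((\<lambda>t. \<rho> t / ereal t) \<longlongrightarrow> \<infinity>) at_top"
begin

abbreviation \<phi> :: "real \<Rightarrow> real" where "\<phi> \<equiv> mono_conj \<rho>"

text \<open>The reverse inequality always holds for \<open>t \<ge> 0\<close>, so this says that the
  supremum defining \<open>\<phi> u\<close> is attained at \<open>t\<close>. In this form it is
  membership in the closed epigraph and involves no subtraction of infinities.\<close>

definition maximizer :: "real \<Rightarrow> real \<Rightarrow> bool" where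
  "maximizer u t \<longleftrightarrow> 0 \<le> t \<and> \<rho> t \<le> ereal (u * t - \<phi> u)"

text \<open>The Fenchel-Young inequality; the real bound \<open>r\<close> on \<open>\<rho> s\<close>
  keeps it inside the reals.\<close>

lemma conj_ge:
  assumes "0 \<le> s" "\<rho> s \<le> ereal r"
  shows "u * s - r \<le> \<phi> u"
proof -
  have "ereal (u * s - r) \<le> ereal (u * s) - \<rho> s"
    using ereal_minus_mono[of "ereal (u * s)" "ereal (u * s)" "\<rho> s" "ereal r"] assms by simp
  also have "\<dots> \<le> mono_conj_ereal \<rho> u"
    unfolding mono_conj_ereal_def using assms(1) by (intro SUP_upper) simp
  also have "\<dots> = ereal (\<phi> u)"
    using mono_conj_finite[OF nonneg zero superlinear] by simp
  finally show ?thesis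
    by simp
qed

lemma conj_nonneg: "0 \<le> \<phi> u"
  using conj_ge[of 0 0 u] zero by simp

lemma conj_approx:
  assumes "e > 0"
  obtains t where "0 \<le> t" "\<rho> t \<le> ereal (u * t - \<phi> u + e)"
proof -
  have "ereal (\<phi> u - e) < mono_conj_ereal \<rho> u"
    using mono_conj_finite[OF nonneg zero superlinear, of u] assms
    by (metis diff_less_eq less_add_same_cancel1 less_ereal.simps(1))
  then obtain t where t: "0 \<le> t" "ereal (\<phi> u - e) < ereal (u * t) - \<rho> t"
    unfolding mono_conj_ereal_def less_SUP_iff by auto
  then have "\<rho> t \<le> ereal (u * t - \<phi> u + e)"
    using nonneg[of t] by (cases "\<rho> t") auto
  then show thesis
    using that t by blast
qed

lemma maximizer_value:
  assumes "maximizer u t"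
  obtains r where "\<rho> t = ereal r" "0 \<le> r" "r = u * t - \<phi> u"
proof -
  obtain r where r: "\<rho> t = ereal r" "0 \<le> r"
    using assms nonneg[of t] unfolding maximizer_def by (cases "\<rho> t") auto
  then have "u * t - r \<le> \<phi> u" "r \<le> u * t - \<phi> u"
    using assms conj_ge[of t r u] by (auto simp: maximizer_def)
  then show thesis
    using that r by fastforce
qed

text \<open>The affine function with slope \<open>t\<close> that competes in the supremum lies below
  \<open>\<phi>\<close> and touches it at \<open>u\<close>.\<close>

lemma maximizer_subgradient:
  assumes "maximizer u t"
  shows "\<phi> u + t * (v - u) \<le> \<phi> v"
  using conj_ge[of t "u * t - \<phi> u" v] assms
  by (simp add: maximizer_def algebra_simps)

text \<open>Monotonicity of subgradients: add the two subgradient inequalities.\<close>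

lemma maximizer_mono:
  assumes "maximizer u s" "maximizer v t" "u < v"
  shows "s \<le> t"
proof -
  have "(s - t) * (v - u) \<le> 0"
    using maximizer_subgradient[OF assms(1), of v] maximizer_subgradient[OF assms(2), of u]
    by (simp add: algebra_simps)
  then show ?thesis
    using assms(3) by (simp add: mult_le_0_iff)
qed

text \<open>For large \<open>t\<close>, superlinearity puts \<open>\<rho> t\<close> above
  \<open>(\<bar>u\<bar> + 1) * t\<close>, which exceeds \<open>u * t + 1\<close>. This supplies the
  compactness for attaining suprema; the slack \<open>1\<close> admits approximate
  maximizers.\<close>

lemma superlevel_bounded:
  obtains B where "\<And>t. \<rho> t \<le> ereal (u * t + 1) \<Longrightarrow> t \<le> B"
proof -
  have "eventually (\<lambda>t. ereal (\<bar>u\<bar> + 1) < \<rho> t / ereal t) at_top"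
    using superlinear by (rule order_tendstoD) simp
  then obtain T where T: "\<And>t. t \<ge> T \<Longrightarrow> ereal (\<bar>u\<bar> + 1) < \<rho> t / ereal t"
    by (auto simp: eventually_at_top_linorder)
  have "t \<le> max T 1" if t: "\<rho> t \<le> ereal (u * t + 1)" for t
  proof (rule ccontr)
    assume "\<not> t \<le> max T 1"
    then have gt: "t > T" "t > 1"
      by auto
    obtain r where r: "\<rho> t = ereal r" "r \<le> u * t + 1"
      using t nonneg[of t] by (cases "\<rho> t") auto
    have "(\<bar>u\<bar> + 1) * t < r"
      using T[of t] gt r(1) by (simp add: field_simps)
    moreover have "u * t \<le> \<bar>u\<bar> * t"
      using gt by (intro mult_right_mono) auto
    ultimately show False
      using r(2) gt(2) by (simp add: distrib_right)
  qed
  then show thesis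
    using that by blast
qed

text \<open>For each fixed competitor \<open>a\<close>, the optimality inequality places points in
  the closed epigraph and passes to the limit; only then is \<open>a\<close> optimized. Thus no
  limit of \<open>\<phi> (x k)\<close> is taken.\<close>

lemma maximizer_closed_graph:
  assumes "x \<longlonglongrightarrow> u" "t \<longlonglongrightarrow> s" "\<And>k::nat. maximizer (x k) (t k)"
  shows "maximizer u s"
  unfolding maximizer_def
proof
  show s: "0 \<le> s"
    using assms(2,3) by (intro LIMSEQ_le_const[of t s 0]) (auto simp: maximizer_def)
  have le: "\<rho> s \<le> ereal (u * s - (u * a - r))" if a: "0 \<le> a" "\<rho> a \<le> ereal r" for a r
  proof -
    have "(t k, x k * t k - (x k * a - r)) \<in> {(t, s::real). \<rho> t \<le> ereal s}" for k
      using assms(3)[of k] conj_ge[OF a, of "x k"]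
      by (auto simp: maximizer_def elim!: order_trans)
    moreover have "(\<lambda>k. (t k, x k * t k - (x k * a - r))) \<longlonglongrightarrow> (s, u * s - (u * a - r))"
      by (intro tendsto_intros assms)
    ultimately show ?thesis
      using closed_sequentially[OF closed_epi] by fast
  qed
  show "\<rho> s \<le> ereal (u * s - \<phi> u)"
  proof (rule ereal_le_epsilon2)
    fix e :: real
    assume "0 < e"
    then obtain a where "0 \<le> a" "\<rho> a \<le> ereal (u * a - \<phi> u + e)"
      by (rule conj_approx)
    then show "\<rho> s \<le> ereal (u * s - \<phi> u) + ereal e"
      using le by (force simp: algebra_simps)
  qed
qed

text \<open>Approximate maximizers stay in a compact interval, and the closed epigraph preserves
  their inequality along a convergent subsequence.\<close>

lemma maximizer_exists: "\<exists>t. maximizer u t"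
proof -
  have "\<exists>t. 0 \<le> t \<and> \<rho> t \<le> ereal (u * t - \<phi> u + 1 / Suc k)" for k
    by (rule conj_approx[of "1 / Suc k" u]) auto
  then obtain t where t: "\<And>k. 0 \<le> t k" "\<And>k. \<rho> (t k) \<le> ereal (u * t k - \<phi> u + 1 / Suc k)"
    by metis
  obtain B where B: "\<And>t. \<rho> t \<le> ereal (u * t + 1) \<Longrightarrow> t \<le> B"
    using superlevel_bounded by blast
  \<comment> \<open>The error \<open>1 / Suc k\<close> is at most \<open>1\<close> and
    \<open>\<phi> u\<close> is nonnegative, which fits the slack in
    \<open>superlevel_bounded\<close>.\<close>
  have "t k \<le> B" for k
  proof (rule B)
    have "u * t k - \<phi> u + 1 / Suc k \<le> u * t k + 1"
      using conj_nonneg[of u] divide_le_eq_1_pos[of "real (Suc k)" 1] by linarith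
    then show "\<rho> (t k) \<le> ereal (u * t k + 1)"
      using t(2)[of k] by (meson ereal_less_eq(3) order_trans)
  qed
  then have "\<forall>k. t k \<in> {0..B}"
    using t(1) by simp
  then obtain s f where s: "s \<in> {0..B}" and f: "strict_mono f" "(t \<circ> f) \<longlonglongrightarrow> s"
    using compact_Icc[of 0 B] unfolding compact_def by metis
  have "(\<lambda>k. (t (f k), u * t (f k) - \<phi> u + 1 / Suc (f k))) \<longlonglongrightarrow> (s, u * s - \<phi> u + 0)"
    using f(2) LIMSEQ_subseq_LIMSEQ[OF LIMSEQ_Suc[OF lim_1_over_n] f(1)]
    by (intro tendsto_intros) (simp_all add: o_def)
  moreover have "(t (f k), u * t (f k) - \<phi> u + 1 / Suc (f k)) \<in> {(t, s::real). \<rho> t \<le> ereal s}" for k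
    using t(2) by simp
  ultimately have "(s, u * s - \<phi> u + 0) \<in> {(t, s::real). \<rho> t \<le> ereal s}"
    using closed_sequentially[OF closed_epi] by fast
  then show ?thesis
    using s by (auto simp: maximizer_def)
qed

definition top_maximizer :: "real \<Rightarrow> real" where
  "top_maximizer u = Sup {t. maximizer u t}"

text \<open>The set of maximizers is nonempty, bounded above, and closed by the closed graph over a
  constant sequence, so it contains its supremum.\<close>

lemma top_maximizer_properties:
  shows top_maximizer: "maximizer u (top_maximizer u)"
    and top_maximizer_greatest: "\<And>t. maximizer u t \<Longrightarrow> t \<le> top_maximizer u"
proof -
  obtain B where B: "\<And>t. \<rho> t \<le> ereal (u * t + 1) \<Longrightarrow> t \<le> B"
    using superlevel_bounded by blast
  have "t \<le> B" if "maximizer u t" for t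
  proof (rule B)
    have "u * t - \<phi> u \<le> u * t + 1"
      using conj_nonneg[of u] by simp
    then show "\<rho> t \<le> ereal (u * t + 1)"
      using that unfolding maximizer_def by (meson ereal_less_eq(3) order_trans)
  qed
  then have bdd: "bdd_above {t. maximizer u t}"
    by (auto simp: bdd_above_def)
  then show "\<And>t. maximizer u t \<Longrightarrow> t \<le> top_maximizer u"
    unfolding top_maximizer_def by (simp add: cSup_upper)
  have "closed {t. maximizer u t}"
    unfolding closed_sequential_limits
    using maximizer_closed_graph[OF tendsto_const] by blast
  then show "maximizer u (top_maximizer u)"
    unfolding top_maximizer_def using closed_contains_Sup[OF _ bdd] maximizer_exists by auto
qed

lemma top_maximizer_nonneg: "0 \<le> top_maximizer u"
  using top_maximizer by (simp add: maximizer_def)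

lemma top_maximizer_mono:
  assumes "u \<le> v"
  shows "top_maximizer u \<le> top_maximizer v"
  using maximizer_mono[OF top_maximizer top_maximizer] assms by (cases "u = v") auto

text \<open>Since \<open>\<rho>\<close> is nonnegative with a zero, \<open>\<phi> 0 = 0\<close>.
  This links the condition on \<open>argmin \<rho>\<close> to the multiplier
  \<open>0\<close>.\<close>

lemma maximizer_0_iff: "maximizer 0 t \<longleftrightarrow> 0 \<le> t \<and> \<rho> t = 0"
proof -
  have "\<phi> 0 \<le> 0"
    using maximizer_exists[of 0] by (elim exE maximizer_value) auto
  then have "\<phi> 0 = 0"
    using conj_nonneg[of 0] by simp
  moreover have "\<rho> t \<le> 0 \<longleftrightarrow> \<rho> t = 0"
    using nonneg[of t] by (metis order_antisym order_refl)
  ultimately show ?thesis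
    by (simp add: maximizer_def flip: zero_ereal_def)
qed

lemma argmin_eq: "argmin \<rho> = {t. \<rho> t = 0}"
proof -
  have "\<rho> t = 0" if "\<forall>s. \<rho> t \<le> \<rho> s" for t
    using that[rule_format, of 0] nonneg[of t] zero by simp
  then show ?thesis
    using nonneg by (auto simp: argmin_def)
qed

text \<open>By monotonicity \<open>\<rho>\<close> vanishes up to \<open>top_maximizer 0\<close>.
  Failing to lie in \<open>argmin \<rho>\<close> thereby becomes the strict inequality that starts
  the secular equation.\<close>

lemma top_maximizer_0_less:
  assumes "\<rho> t \<noteq> 0"
  shows "top_maximizer 0 < t"
proof (rule ccontr)
  assume "\<not> top_maximizer 0 < t"
  then have "\<rho> t \<le> \<rho> (top_maximizer 0)"
    using mono by (simp add: monoD)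
  then show False
    using top_maximizer[of 0] nonneg[of t] assms by (auto simp: maximizer_0_iff)
qed

text \<open>Comparison with a fixed point \<open>t0 > 0\<close> of finite penalty keeps maximizers
  away from \<open>0\<close> for large \<open>u\<close>, whereas the resolvent norm tends to
  \<open>0\<close>.\<close>

lemma top_maximizer_bound_below:
  obtains c u0 where "c > 0" "\<And>u. u \<ge> u0 \<Longrightarrow> c \<le> top_maximizer u"
proof -
  obtain t0 r where t0: "t0 > 0" "\<rho> t0 = ereal r" "0 \<le> r"
  proof -
    obtain t0 where "t0 > 0" "\<rho> t0 < \<infinity>"
      using nontrivial by blast
    then show thesis
      using that nonneg[of t0] by (cases "\<rho> t0") auto
  qed
  \<comment> \<open>The bound \<open>2 * r / t0\<close> makes \<open>r\<close> at most half of
    \<open>u * t0\<close>; the bound \<open>1\<close> makes \<open>u\<close> positive for the final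
    cancellation.\<close>
  have "t0 / 2 \<le> top_maximizer u" if u: "u \<ge> max 1 (2 * r / t0)" for u
  proof -
    obtain q where "0 \<le> q" "q = u * top_maximizer u - \<phi> u"
      using maximizer_value[OF top_maximizer] by metis
    then have "u * t0 - r \<le> u * top_maximizer u"
      using conj_ge[of t0 r u] t0 by simp
    moreover have "r \<le> u * t0 / 2"
      using u t0(1) by (simp add: field_simps)
    ultimately have "u * (t0 / 2) \<le> u * top_maximizer u"
      by simp
    then show ?thesis
      using u by simp
  qed
  then show thesis
    using that[of "t0 / 2" "max 1 (2 * r / t0)"] t0(1) by simp
qed

end

section \<open>Maximizers as derivatives of a smooth conjugate\<close>

locale smooth_penalty = superlinear_penalty +
  assumes smooth: "\<And>u. u > 0 \<Longrightarrow> mono_conj \<rho> differentiable (at u)"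
begin

text \<open>By the subgradient inequality \<open>\<phi> v - t * v\<close> is minimal at
  \<open>v = u\<close>, so its derivative vanishes there. In particular the maximizer is unique for
  \<open>u > 0\<close>.\<close>

lemma maximizer_eq_deriv:
  assumes "maximizer u t" "u > 0"
  shows "t = deriv \<phi> u"
proof -
  have "(\<phi> has_real_derivative deriv \<phi> u) (at u)"
    using smooth[OF assms(2)] by (simp add: DERIV_deriv_iff_real_differentiable)
  then have "((\<lambda>v. \<phi> v - t * v) has_real_derivative deriv \<phi> u - t) (at u)"
    by (auto intro!: derivative_eq_intros)
  moreover have "\<phi> u - t * u \<le> \<phi> v - t * v" for v
    using maximizer_subgradient[OF assms(1), of v] by (simp add: algebra_simps)
  ultimately have "deriv \<phi> u - t = 0"
    by (intro DERIV_local_min[of "\<lambda>v. \<phi> v - t * v" _ u 1]) auto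
  then show ?thesis
    by simp
qed

lemma deriv_conj: "u > 0 \<Longrightarrow> deriv \<phi> u = top_maximizer u"
  using maximizer_eq_deriv[OF top_maximizer] by simp

text \<open>A closed graph with values in a compact set gives continuity. Limits of maximizers are
  maximizers, so it remains to see that the limit is the top one.\<close>

lemma continuous_on_top_maximizer: "continuous_on {0..b} top_maximizer"
proof (rule continuous_from_closed_graph)
  let ?G = "(\<lambda>u. (u, top_maximizer u)) ` {0..b}"
  show "compact {0..top_maximizer b}"
    by simp
  show "top_maximizer \<in> {0..b} \<rightarrow> {0..top_maximizer b}"
    using top_maximizer_nonneg top_maximizer_mono by auto
  show "closed ?G"
    unfolding closed_sequential_limits
  proof (intro allI impI)
    fix X :: "nat \<Rightarrow> real \<times> real" and l
    assume X: "(\<forall>k. X k \<in> ?G) \<and> X \<longlonglongrightarrow> l"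
    define x where "x k = fst (X k)" for k
    have x: "x k \<in> {0..b}" "snd (X k) = top_maximizer (x k)" for k
    proof -
      have "X k \<in> ?G"
        using X by blast
      then show "x k \<in> {0..b}" "snd (X k) = top_maximizer (x k)"
        unfolding x_def by auto
    qed
    have lim: "x \<longlonglongrightarrow> fst l" "(\<lambda>k. top_maximizer (x k)) \<longlonglongrightarrow> snd l"
      using tendsto_fst[of X l sequentially] tendsto_snd[of X l sequentially] X x(2)
      by (auto simp: x_def[abs_def])
    have u: "fst l \<in> {0..b}"
      using closed_sequentially[OF closed_atLeastAtMost _ lim(1)] x(1) by blast
    have max: "maximizer (fst l) (snd l)"
      by (rule maximizer_closed_graph[OF lim]) (rule top_maximizer)
    have "snd l = top_maximizer (fst l)"
    proof (cases "fst l = 0")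
      \<comment> \<open>Uniqueness may fail at \<open>0\<close>, but the approximating values all
        lie above \<open>top_maximizer 0\<close> by monotonicity, so their limit cannot be a smaller
        maximizer.\<close>
      case True
      have "top_maximizer 0 \<le> snd l"
        using x(1) by (intro LIMSEQ_le_const[OF lim(2)]) (auto intro: top_maximizer_mono)
      then show ?thesis
        using top_maximizer_greatest[OF max] True by simp
    next
      case False
      then show ?thesis
        using maximizer_eq_deriv[OF max] u by (simp add: deriv_conj)
    qed
    then show "l \<in> ?G"
      using u by (cases l) auto
  qed
qed

text \<open>At \<open>0\<close>, where the conjugate need not be differentiable, its right derivative is the
  \<^emph>\<open>largest\<close> maximizer; this is what makes \<^const>\<open>top_maximizer\<close> continuous up to \<open>0\<close>.\<close>
lemma right_deriv_conj:
  assumes "u \<ge> 0"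
  shows "right_deriv \<phi> u = top_maximizer u"
proof -
  have "continuous_on {u..u+1} top_maximizer"
    using continuous_on_top_maximizer[of "u+1"] by (rule continuous_on_subset) (use assms in auto)
  then have T: "(top_maximizer \<longlongrightarrow> top_maximizer u) (at_right u)"
    by (rule continuous_on_Icc_at_rightD) simp
  \<comment> \<open>The subgradient inequalities at \<open>u\<close> and at \<open>v\<close> trap
    the difference quotient between \<open>top_maximizer u\<close> and
    \<open>top_maximizer v\<close>.\<close>
  have "((\<lambda>v. (\<phi> v - \<phi> u) / (v - u)) \<longlongrightarrow> top_maximizer u) (at_right u)"
  proof (rule tendsto_sandwich[OF _ _ tendsto_const T])
    show "\<forall>\<^sub>F v in at_right u. top_maximizer u \<le> (\<phi> v - \<phi> u) / (v - u)"
      using maximizer_subgradient[OF top_maximizer, of u]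
      by (auto simp: eventually_at_right_field field_simps intro!: exI[of _ "u + 1"])
    show "\<forall>\<^sub>F v in at_right u. (\<phi> v - \<phi> u) / (v - u) \<le> top_maximizer v"
      using maximizer_subgradient[OF top_maximizer, of _ u]
      by (auto simp: eventually_at_right_field field_simps intro!: exI[of _ "u + 1"])
  qed
  then have D: "(\<phi> has_real_derivative top_maximizer u) (at_right u)"
    by (simp add: has_field_derivative_iff)
  show ?thesis
    unfolding right_deriv_def
  proof (rule the_equality)
    show "(\<phi> has_real_derivative top_maximizer u) (at_right u)"
      by (rule D)
    fix D' assume "(\<phi> has_real_derivative D') (at_right u)"
    then show "D' = top_maximizer u"
      using D tendsto_unique[OF trivial_limit_at_right_real] unfolding has_field_derivative_iff by blast
  qed
qed

end

subsection \<open>The secular equation\<close>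

text \<open>Definiteness is required at the endpoint \<open>b\<close> itself and is inherited by all
  \<open>l \<le> b\<close>. The instances are \<open>H\<close> with endpoint \<open>0\<close> and
  \<open>H + P\<close> with endpoint \<open>lambda_min H\<close>.\<close>

locale coercive_family =
  fixes M :: "real^'n^'n" and b :: real
  assumes sym: "symmetric_matrix M" and pd: "positive_definite (shifted M b)"
begin

definition res :: "real^'n \<Rightarrow> real \<Rightarrow> real^'n" where
  "res g l = matrix_inv (shifted M l) *v g"

lemma positive_definite_shifted: "l \<le> b \<Longrightarrow> positive_definite (shifted M l)"
  using positive_definite_shifted_mono[OF pd sym] .

lemma shifted_res: "l \<le> b \<Longrightarrow> shifted M l *v res g l = g"
  unfolding res_def
  by (intro matrix_inv_vmult_right positive_definite_invertible positive_definite_shifted)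

text \<open>Here \<open>c\<close> is the least eigenvalue of \<open>shifted M b\<close>, and
  Cauchy-Schwarz turns the form bound into a norm bound. Positivity of \<open>c\<close> gives
  uniform control up to \<open>b\<close>; the growth in \<open>- l\<close> gives decay at minus
  infinity.\<close>

lemma coercive:
  obtains c where "c > 0" "\<And>l x. l \<le> b \<Longrightarrow> (c + b - l) * norm x \<le> norm (shifted M l *v x)"
proof -
  obtain c v where v: "norm v = 1" "shifted M b *v v = c *\<^sub>R v"
    and c: "\<And>x. c * (norm x)\<^sup>2 \<le> x \<bullet> (shifted M b *v x)"
    using rayleigh_minimum[OF symmetric_matrix_shifted[OF sym]] by metis
  have "v \<noteq> 0"
    using v(1) by auto
  then have "0 < v \<bullet> (shifted M b *v v)"
    using pd by (simp add: positive_definite_def)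
  then have "c > 0"
    using v by (simp flip: power2_norm_eq_inner)
  moreover have "(c + b - l) * norm x \<le> norm (shifted M l *v x)" for l x
  proof (cases "x = 0")
    case False
    have "(c + b - l) * (norm x)\<^sup>2 \<le> x \<bullet> (shifted M l *v x)"
      using c[of x] by (simp add: shifted_vmult inner_diff power2_norm_eq_inner algebra_simps)
    also have "\<dots> \<le> norm x * norm (shifted M l *v x)"
      by (rule norm_cauchy_schwarz)
    finally show ?thesis
      using False by (simp add: power2_eq_square mult.left_commute)
  qed simp
  ultimately show thesis
    using that by blast
qed

text \<open>The resolvent identity expresses the difference of two values through
  \<open>(l - m) *\<^sub>R res g m\<close>; applying coercivity twice makes it Lipschitz.\<close>

lemma continuous_on_res: "continuous_on {..b} (res g)"
proof -
  obtain c where c: "c > 0"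
    "\<And>l x. l \<le> b \<Longrightarrow> (c + b - l) * norm x \<le> norm (shifted M l *v x)"
    using coercive by blast
  have c': "norm x \<le> norm (shifted M l *v x) / c" if "l \<le> b" for l x
  proof -
    have "c * norm x \<le> (c + b - l) * norm x"
      using that by (intro mult_right_mono) auto
    then have "c * norm x \<le> norm (shifted M l *v x)"
      using c(2)[OF that, of x] by linarith
    then show ?thesis
      using c(1) by (simp add: field_simps)
  qed
  have "(norm g / c / c)-lipschitz_on {..b} (res g)"
  proof (rule lipschitz_onI)
    fix l m assume lm: "l \<in> {..b}" "m \<in> {..b}"
    have "shifted M l *v (res g l - res g m) = (l - m) *\<^sub>R res g m"
      using shifted_res[of l g] shifted_res[of m g] lm
      by (simp add: shifted_vmult algebra_simps)
    then have "norm (res g l - res g m) \<le> \<bar>l - m\<bar> * norm (res g m) / c"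
      using c'[of l "res g l - res g m"] lm by simp
    also have "\<dots> \<le> \<bar>l - m\<bar> * (norm g / c) / c"
      using c'[of m "res g m"] lm c(1)
      by (intro divide_right_mono mult_left_mono) (auto simp: shifted_res)
    finally show "dist (res g l) (res g m) \<le> norm g / c / c * dist l m"
      by (simp add: dist_norm mult.commute)
  qed (use c(1) in auto)
  then show ?thesis
    by (rule lipschitz_on_continuous_on)
qed

lemma norm_res_tendsto_0: "((\<lambda>l. (norm (res g l))\<^sup>2) \<longlongrightarrow> 0) at_bot"
proof -
  obtain c where c: "c > 0"
    "\<And>l x. l \<le> b \<Longrightarrow> (c + b - l) * norm x \<le> norm (shifted M l *v x)"
    using coercive by blast
  have "((\<lambda>l. norm (res g l)) \<longlongrightarrow> 0) at_bot"
  proof (rule tendsto_sandwich[OF _ _ tendsto_const])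
    have "filterlim (\<lambda>l. (c + b) + - l) at_top at_bot"
      by (rule filterlim_tendsto_add_at_top[OF tendsto_const filterlim_uminus_at_top_at_bot])
    then show "((\<lambda>l. norm g / ((c + b) + - l)) \<longlongrightarrow> 0) at_bot"
      by (rule real_tendsto_divide_at_top[OF tendsto_const])
    show "\<forall>\<^sub>F l in at_bot. norm (res g l) \<le> norm g / ((c + b) + - l)"
      using eventually_le_at_bot[of b]
    proof eventually_elim
      case (elim l)
      then show ?case
        using c(2)[OF elim, of "res g l"] c(1) by (simp add: shifted_res field_simps)
    qed
  qed simp
  from tendsto_power[OF this, of 2] show ?thesis
    by simp
qed

text \<open>The difference of squares is \<open>d \<bullet> (t + s)\<close>. Both \<open>t\<close>
  and \<open>s\<close> are positive multiples of images of \<open>d\<close> under positive definite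
  matrices, so each has positive inner product with \<open>d\<close>.\<close>

lemma norm_res_strict_mono:
  assumes "g \<noteq> 0" "l < m" "m \<le> b"
  shows "(norm (res g l))\<^sup>2 < (norm (res g m))\<^sup>2"
proof -
  define s t d where "s = res g l" and "t = res g m" and "d = t - s"
  have s: "shifted M l *v s = g" and t: "shifted M m *v t = g"
    using assms by (simp_all add: s_def t_def shifted_res)
  have pos: "0 < x \<bullet> (shifted M l *v x)" "0 < x \<bullet> (shifted M m *v x)" if "x \<noteq> 0" for x
    using positive_definite_shifted that assms by (auto simp: positive_definite_def)
  have dl: "shifted M l *v d = (m - l) *\<^sub>R t" and dm: "shifted M m *v d = (m - l) *\<^sub>R s"
    using s t by (simp_all add: d_def shifted_vmult algebra_simps)
  have "t \<noteq> 0"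
    using t assms(1) by auto
  then have "d \<noteq> 0"
    using dl assms(2) by auto
  then have "0 < d \<bullet> t" "0 < d \<bullet> s"
    using pos[of d] assms(2) by (auto simp: dl dm zero_less_mult_iff)
  then have "0 < d \<bullet> (t + s)"
    by (simp add: inner_add_right)
  also have "\<dots> = (norm t)\<^sup>2 - (norm s)\<^sup>2"
    by (simp add: d_def power2_norm_eq_inner algebra_simps inner_commute)
  finally show ?thesis
    by (simp add: s_def t_def)
qed

end

section \<open>Existence of the multiplier and its sufficiency for optimality\<close>

context smooth_penalty
begin

text \<open>The left side strictly increases with the multiplier while the right side decreases, and
  the inequality between them is reversed near minus infinity.\<close>
lemma secular_equation:
  assumes "coercive_family M b" "b \<le> 0" "g \<noteq> 0"
    and gt: "top_maximizer (- b) < (norm (matrix_inv (shifted M b) *v g))\<^sup>2"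
  shows "\<exists>l<b. (norm (matrix_inv (shifted M l) *v g))\<^sup>2 = top_maximizer (- l) \<and>
    (\<forall>m<b. (norm (matrix_inv (shifted M m) *v g))\<^sup>2 = top_maximizer (- m) \<longrightarrow> m = l)"
proof -
  interpret coercive_family M b
    by fact
  define F where "F l = (norm (res g l))\<^sup>2 - top_maximizer (- l)" for l
  have mono: "F l < F m" if "l < m" "m \<le> b" for l m
    using norm_res_strict_mono[OF \<open>g \<noteq> 0\<close> that] top_maximizer_mono[of "- m" "- l"] that
    by (simp add: F_def)
  obtain c u0 where c: "c > 0" "\<And>u. u \<ge> u0 \<Longrightarrow> c \<le> top_maximizer u"
    using top_maximizer_bound_below by blast
  have "\<forall>\<^sub>F l in at_bot. (norm (res g l))\<^sup>2 < c"
    using norm_res_tendsto_0 c(1) by (rule order_tendstoD)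
  then have "\<forall>\<^sub>F l in at_bot. F l < 0 \<and> l \<le> b"
    using eventually_le_at_bot[of "- u0"] eventually_le_at_bot[of b]
  proof eventually_elim
    case (elim l)
    then show ?case
      using c(2)[of "- l"] by (simp add: F_def)
  qed
  then obtain a where a: "F a < 0" "a \<le> b"
    using eventually_happens by force
  \<comment> \<open>When \<open>b = 0\<close> the argument \<open>- l\<close> reaches
    \<open>0\<close>, so continuity of \<open>top_maximizer\<close> at that closed endpoint is
    essential.\<close>
  have "continuous_on {a..b} (\<lambda>l. top_maximizer (- l))"
    by (rule continuous_on_compose2[OF continuous_on_top_maximizer[of "- a"]])
      (use \<open>b \<le> 0\<close> in \<open>auto intro!: continuous_intros\<close>)
  moreover have "continuous_on {a..b} (res g)"
    by (rule continuous_on_subset[OF continuous_on_res]) auto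
  ultimately have "continuous_on {a..b} F"
    unfolding F_def[abs_def] by (intro continuous_intros)
  moreover have Fb: "0 < F b"
    using gt by (simp add: F_def res_def)
  ultimately obtain l where l: "l \<le> b" "F l = 0"
    using IVT'[of F a 0 b] a by auto
  have "l \<noteq> b"
    using l(2) Fb by auto
  then have "l < b"
    using l(1) by simp
  moreover have "m = l" if "m < b" "F m = 0" for m
    using mono[of l m] mono[of m l] that l \<open>l < b\<close> by (cases m l rule: linorder_cases) auto
  ultimately have "\<exists>l<b. F l = 0 \<and> (\<forall>m<b. F m = 0 \<longrightarrow> m = l)"
    using l(2) by blast
  then show ?thesis
    by (simp add: F_def res_def)
qed

text \<open>Adding and subtracting \<open>l * (norm x)\<^sup>2\<close> splits the objective into a
  convex quadratic, stationary at \<open>x\<close>, and a function of the squared norm, minimal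
  there by the maximizer property.\<close>

lemma solves_P_if_maximizer:
  assumes sym: "symmetric_matrix H" and psd: "\<And>y. 0 \<le> y \<bullet> (shifted H l *v y)"
    and stat: "shifted H l *v x = - g" and max: "maximizer (- l) ((norm x)\<^sup>2)"
  shows "solves_P g H \<rho> x"
  unfolding solves_P_def argmin_def
proof (intro CollectI allI)
  fix y
  obtain r where r: "\<rho> ((norm x)\<^sup>2) = ereal r" "r = - l * (norm x)\<^sup>2 - \<phi> (- l)"
    using maximizer_value[OF max] by metis
  show "objective g H \<rho> x \<le> objective g H \<rho> y"
  proof (cases "\<rho> ((norm y)\<^sup>2)")
    case (real q)
    have Hx: "H *v x = l *\<^sub>R x - g"
      using stat by (simp add: shifted_vmult diff_eq_eq)
    have "- l * (norm y)\<^sup>2 - q \<le> \<phi> (- l)"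
      using real by (intro conj_ge) auto
    then have "r + l * (x \<bullet> x) \<le> q + l * (y \<bullet> y)"
      using r(2) by (simp add: power2_norm_eq_inner)
    moreover have "x \<bullet> (H *v y) = l * (x \<bullet> y) - g \<bullet> y"
      by (simp add: symmetric_matrix_inner[OF sym] Hx inner_diff_left)
    \<comment> \<open>By stationarity the gap between the two sides is exactly the form of
      \<open>shifted H l\<close> at \<open>y - x\<close>.\<close>
    then have "2 * (g \<bullet> x) + x \<bullet> (H *v x) - l * (x \<bullet> x)
        \<le> 2 * (g \<bullet> y) + y \<bullet> (H *v y) - l * (y \<bullet> y)"
      using psd[of "y - x"]
      by (simp add: shifted_vmult matrix_vector_mult_diff_distrib inner_diff Hx inner_commute)
        (simp add: algebra_simps inner_commute)
    ultimately show ?thesis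
      using real r by (simp add: objective_def)
  qed (use nonneg[of "(norm y)\<^sup>2"] in \<open>auto simp: objective_def\<close>)
qed

end

section \<open>Regularization on the lowest eigenspace\<close>

locale kernel_shift =
  fixes H P :: "real^'n^'n"
  assumes symH: "symmetric_matrix H" and symP: "symmetric_matrix P"
    and P_in: "\<And>x. P *v x \<in> mat_ker (shifted H (lambda_min H))"
    and P_id: "\<And>k. k \<in> mat_ker (shifted H (lambda_min H)) \<Longrightarrow> P *v k = k"
begin

abbreviation "\<mu> \<equiv> lambda_min H"

lemma psd: "0 \<le> x \<bullet> (shifted H \<mu> *v x)"
  using lambda_min_le[OF symH, of x] by (simp add: shifted_vmult inner_diff power2_norm_eq_inner)

lemma positive_definite_below: "l < \<mu> \<Longrightarrow> positive_definite (shifted H l)"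
  unfolding positive_definite_def
proof (intro conjI allI impI symmetric_matrix_shifted symH)
  fix x :: "real^'n"
  assume "l < \<mu>" "x \<noteq> 0"
  then have "0 < (\<mu> - l) * (x \<bullet> x)"
    by simp
  then show "0 < x \<bullet> (shifted H l *v x)"
    using psd[of x] by (simp add: shifted_vmult inner_diff algebra_simps)
qed

lemma P_quad: "x \<bullet> (P *v x) = (P *v x) \<bullet> (P *v x)"
  using symmetric_matrix_inner[OF symP, of x "P *v x"] by (simp add: P_id[OF P_in] inner_commute)

lemma shifted_add_P: "shifted (H + P) l = shifted H l + P"
  by (simp add: shifted_def)

text \<open>The form of \<open>shifted (H + P) \<mu>\<close> is a nonnegative form plus the squared
  norm of \<open>P *v x\<close>. If both vanish, \<open>x\<close> lies in the kernel, where
  \<open>P\<close> is the identity, so \<open>x = 0\<close>.\<close>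

sublocale coercive_family "H + P" "lambda_min H"
proof
  show symM: "symmetric_matrix (H + P)"
    by (rule symmetric_matrixI)
      (simp add: matrix_vector_mult_add_rdistrib inner_add symmetric_matrix_inner[OF symH]
        symmetric_matrix_inner[OF symP])
  show "positive_definite (shifted (H + P) \<mu>)"
    unfolding positive_definite_def
  proof (intro conjI allI impI symmetric_matrix_shifted symM)
    fix x :: "real^'n"
    assume "x \<noteq> 0"
    have eq: "x \<bullet> (shifted (H + P) \<mu> *v x) = x \<bullet> (shifted H \<mu> *v x) + (P *v x) \<bullet> (P *v x)"
      by (simp add: shifted_add_P matrix_vector_mult_add_rdistrib inner_add_right P_quad)
    have "x \<bullet> (shifted (H + P) \<mu> *v x) \<noteq> 0"
    proof
      assume "x \<bullet> (shifted (H + P) \<mu> *v x) = 0"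
      then have "x \<bullet> (shifted H \<mu> *v x) = 0" "P *v x = 0"
        using add_nonneg_eq_0_iff[OF psd inner_ge_zero] unfolding eq by auto
      then have "x \<in> mat_ker (shifted H \<mu>)"
        using psd_kernel[OF symmetric_matrix_shifted[OF symH] psd] by (simp add: mat_ker_def)
      then show False
        using P_id \<open>P *v x = 0\<close> \<open>x \<noteq> 0\<close> by auto
    qed
    then show "0 < x \<bullet> (shifted (H + P) \<mu> *v x)"
      using psd[of x] inner_ge_zero[of "P *v x"] unfolding eq by linarith
  qed
qed

lemma range_orthogonal_ker:
  assumes "g \<in> mat_range (shifted H \<mu>)" "k \<in> mat_ker (shifted H \<mu>)"
  shows "k \<bullet> g = 0"
  using assms symmetric_matrix_inner[OF symmetric_matrix_shifted[OF symH]]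
  by (auto simp: mat_range_def mat_ker_def)

lemma P_eq_0:
  assumes "\<And>k. k \<in> mat_ker (shifted H \<mu>) \<Longrightarrow> k \<bullet> x = 0"
  shows "P *v x = 0"
  using assms[OF P_in, of x] P_quad[of x] by (simp add: inner_commute)

text \<open>A kernel vector \<open>k\<close> is an eigenvector of \<open>shifted (H + P) l\<close>
  with eigenvalue \<open>\<mu> - l + 1 > 0\<close>; pair the resolvent equation with
  \<open>k\<close> and use that \<open>g\<close> is orthogonal to \<open>k\<close>.\<close>

lemma res_orthogonal_ker:
  assumes g: "g \<in> mat_range (shifted H \<mu>)" and l: "l \<le> \<mu>" and k: "k \<in> mat_ker (shifted H \<mu>)"
  shows "k \<bullet> res g l = 0"
proof -
  have "H *v k = \<mu> *\<^sub>R k"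
    using k by (simp add: mat_ker_def shifted_vmult)
  moreover have "k \<bullet> (shifted (H + P) l *v res g l) = 0"
    using range_orthogonal_ker[OF g k] l by (simp add: shifted_res)
  ultimately have "(\<mu> - l + 1) * (k \<bullet> res g l) = 0"
    using P_id[OF k]
    by (simp add: shifted_vmult matrix_vector_mult_add_rdistrib inner_add_right inner_diff_right
        symmetric_matrix_inner[OF symH] symmetric_matrix_inner[OF symP] algebra_simps)
  then show ?thesis
    using l by simp
qed

lemma shifted_H_res:
  assumes "g \<in> mat_range (shifted H \<mu>)" "l \<le> \<mu>"
  shows "shifted H l *v res g l = g"
  using shifted_res[OF assms(2), of g] P_eq_0[OF res_orthogonal_ker[OF assms]]
  by (simp add: shifted_add_P matrix_vector_mult_add_rdistrib)

lemma matrix_inv_eq_res: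
  assumes "g \<in> mat_range (shifted H \<mu>)" "l < \<mu>"
  shows "matrix_inv (shifted H l) *v g = res g l"
  using matrix_inv_vmult_left[OF positive_definite_invertible[OF positive_definite_below[OF assms(2)]],
      of "res g l"] shifted_H_res[of g l] assms by simp

text \<open>\<open>shifted (H + P) \<mu>\<close> acts as the identity on the kernel and as
  \<open>shifted H \<mu>\<close> on its orthogonal complement. Subtracting \<open>P\<close> from the
  inverse makes it vanish on the kernel, as the pseudoinverse must.\<close>

lemma pinv_lambda_min:
  "pinv (shifted H \<mu>) = matrix_inv (shifted (H + P) \<mu>) - P"
proof (rule pinv_eqI)
  define A C where "A = shifted H \<mu>" and "C = shifted (H + P) \<mu>"
  have C: "C = A + P"
    by (simp add: A_def C_def shifted_add_P)
  have inv: "C ** matrix_inv C = mat 1" "matrix_inv C ** C = mat 1"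
    using invertible_matrix_inv positive_definite_invertible[OF pd] by (auto simp: C_def)
  have AP: "A ** P = 0"
    using P_in by (auto simp: matrix_eq A_def mat_ker_def simp flip: matrix_vector_mul_assoc)
  have PP: "P ** P = P"
    using P_id[OF P_in] by (auto simp: matrix_eq simp flip: matrix_vector_mul_assoc)
  have tA: "transpose A = A" and tP: "transpose P = P"
    using symmetric_matrix_shifted[OF symH] symP by (simp_all add: symmetric_matrix_def A_def)
  have PA: "P ** A = 0"
  proof -
    have "transpose (A ** P) = 0"
      by (simp add: AP transpose_def vec_eq_iff)
    then show ?thesis
      by (simp add: matrix_transpose_mul tA tP)
  qed
  have "(A + P) ** P = A ** P + P ** P"
    by (simp add: matrix_eq algebra_simps flip: matrix_vector_mul_assoc)
  then have CP: "C ** P = P" "P ** C = P"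
    by (simp_all add: C matrix_add_ldistrib AP PA PP)
  have iP: "matrix_inv C ** P = P" "P ** matrix_inv C = P"
  proof -
    have "matrix_inv C ** (C ** P) = P" "(P ** C) ** matrix_inv C = P"
      by (simp_all add: matrix_mul_assoc inv flip: matrix_mul_assoc[of P])
    then show "matrix_inv C ** P = P" "P ** matrix_inv C = P"
      by (simp_all add: CP)
  qed
  have sub_l: "X ** (Y - Z) = X ** Y - X ** Z" and sub_r: "(Y - Z) ** X = Y ** X - Z ** X"
    for X Y Z :: "real^'n^'n"
    by (simp_all add: matrix_eq algebra_simps flip: matrix_vector_mul_assoc)
  have A: "A = C - P"
    by (simp add: C)
  \<comment> \<open>Both products are the orthogonal projection onto the complement of the kernel,
    which gives the two symmetry conditions at once.\<close>
  have "A ** (matrix_inv C - P) = mat 1 - P" "(matrix_inv C - P) ** A = mat 1 - P"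
    unfolding A by (simp_all add: sub_l sub_r inv iP CP PP)
  moreover have "transpose (mat 1 - P) = mat 1 - P"
    using tP by (simp add: transpose_def vec_eq_iff mat_def)
  ultimately show "is_pinv (shifted H \<mu>) (matrix_inv (shifted (H + P) \<mu>) - P)"
    unfolding is_pinv_def A_def[symmetric] C_def[symmetric]
    by (simp add: sub_l sub_r PA PP iP)
qed

text \<open>One resolvent covers the ordinary inverses below \<open>\<mu>\<close> and the
  pseudoinverse at \<open>\<mu>\<close>, so continuity up to the endpoint is that of
  \<open>res g\<close>.\<close>

lemma pinv_eq_res:
  assumes "g \<in> mat_range (shifted H \<mu>)" "l \<le> \<mu>"
  shows "pinv (shifted H l) *v g = res g l"
proof (cases "l = \<mu>")
  case True
  have "P *v g = 0"
    using P_eq_0 range_orthogonal_ker[OF assms(1)] by blast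
  then show ?thesis
    using True by (simp add: pinv_lambda_min matrix_vector_mult_diff_rdistrib res_def)
next
  case False
  then have "l < \<mu>"
    using assms(2) by simp
  then show ?thesis
    using pinv_invertible[OF positive_definite_invertible[OF positive_definite_below]]
      matrix_inv_eq_res[OF assms(1)] by simp
qed

end

lemma kernel_shift_exists:
  assumes "symmetric_matrix H"
  shows "\<exists>P. kernel_shift H P"
proof -
  obtain P where "symmetric_matrix P"
    "\<And>x. P *v x \<in> mat_ker (shifted H (lambda_min H))"
    "\<And>k. k \<in> mat_ker (shifted H (lambda_min H)) \<Longrightarrow> P *v k = k"
    using orthogonal_projection_matrix[OF subspace_mat_ker] by metis
  then show ?thesis
    using assms by (auto simp: kernel_shift_def)
qed

section \<open>The regular and the degenerate cases, by the position of the multiplier\<close>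

theorem theorem3p5:
  fixes g :: "real^'n" and H :: "real^'n^'n" and \<rho> :: "real \<Rightarrow> ereal"
  assumes "g \<noteq> 0"
    and "symmetric_matrix H"
    and "\<And>t. 0 \<le> \<rho> t"
    and "proper_closed_convex \<rho>"
    and "\<rho> 0 = 0"
    and "mono \<rho>"
    and "\<And>t. t \<le> 0 \<Longrightarrow> \<rho> t = 0"
    and "\<exists>t0>0. \<rho> t0 < \<infinity>"
    and "((\<lambda>t. \<rho> t / ereal t) \<longlongrightarrow> \<infinity>) at_top"
    and "\<And>t. t > 0 \<Longrightarrow> mono_conj \<rho> differentiable (at t)"
  shows "(positive_definite H \<longrightarrow>
      ((norm (matrix_inv H *v g))\<^sup>2 \<in> argmin \<rho> \<longrightarrow>
        solves_P g H \<rho> (- (matrix_inv H *v g))) \<and>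
      ((norm (matrix_inv H *v g))\<^sup>2 \<notin> argmin \<rho> \<longrightarrow>
        (\<exists>l<0.
          (norm (matrix_inv (shifted H l) *v g))\<^sup>2 = deriv (mono_conj \<rho>) (- l) \<and>
          (\<forall>m<0. (norm (matrix_inv (shifted H m) *v g))\<^sup>2 = deriv (mono_conj \<rho>) (- m)
             \<longrightarrow> m = l) \<and>
          solves_P g H \<rho> (- (matrix_inv (shifted H l) *v g)))))
    \<and>
    (lambda_min H \<le> 0 \<and> g \<in> mat_range (shifted H (lambda_min H)) \<longrightarrow>
      continuous_on {..lambda_min H} (\<lambda>l. pinv (shifted H l) *v g) \<and>
      (norm (pinv (shifted H (lambda_min H)) *v g)
          > sqrt (right_deriv (mono_conj \<rho>) (- lambda_min H)) \<longrightarrow>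
        (\<exists>l<lambda_min H.
          (norm (matrix_inv (shifted H l) *v g))\<^sup>2 = deriv (mono_conj \<rho>) (- l) \<and>
          (\<forall>m<lambda_min H.
             (norm (matrix_inv (shifted H m) *v g))\<^sup>2 = deriv (mono_conj \<rho>) (- m)
             \<longrightarrow> m = l) \<and>
          solves_P g H \<rho> (- (matrix_inv (shifted H l) *v g)))) \<and>
      (norm (pinv (shifted H (lambda_min H)) *v g)
          \<le> sqrt (right_deriv (mono_conj \<rho>) (- lambda_min H)) \<longrightarrow>
        (\<exists>\<alpha> v. v \<in> mat_ker (shifted H (lambda_min H)) - {0} \<and>
          right_deriv (mono_conj \<rho>) (- lambda_min H)
            = (norm (pinv (shifted H (lambda_min H)) *v g - \<alpha> *\<^sub>R v))\<^sup>2 \<and>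
          solves_P g H \<rho> (- (pinv (shifted H (lambda_min H)) *v g) + \<alpha> *\<^sub>R v))))"
proof -
  interpret smooth_penalty \<rho>
    using assms by unfold_locales (auto simp: proper_closed_convex_def)
  have solves: "solves_P g H \<rho> (- (matrix_inv (shifted H l) *v g))"
    if "positive_definite (shifted H l)" "maximizer (- l) ((norm (matrix_inv (shifted H l) *v g))\<^sup>2)"
    for l
  proof (rule solves_P_if_maximizer[of _ l])
    show "0 \<le> y \<bullet> (shifted H l *v y)" for y
      using that(1) by (cases "y = 0") (auto simp: positive_definite_def less_imp_le)
    show "shifted H l *v - (matrix_inv (shifted H l) *v g) = - g"
      using matrix_inv_vmult_right[OF positive_definite_invertible[OF that(1)], of g]
        matrix_vector_mult_diff_distrib[of "shifted H l" 0] by simp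
  qed (use assms(2) that(2) in simp_all)
  show ?thesis
  proof (intro conjI impI)
    assume pd: "positive_definite H" and min: "(norm (matrix_inv H *v g))\<^sup>2 \<in> argmin \<rho>"
    \<comment> \<open>The multiplier is \<open>0\<close> here: minimizers of \<open>\<rho>\<close>
      that are squared norms are exactly the maximizers at \<open>0\<close>.\<close>
    then show "solves_P g H \<rho> (- (matrix_inv H *v g))"
      using solves[of 0] by (simp add: shifted_def maximizer_0_iff argmin_eq)
  next
    assume pd: "positive_definite H" and not_min: "(norm (matrix_inv H *v g))\<^sup>2 \<notin> argmin \<rho>"
    have "coercive_family H 0"
      using pd assms(2) by unfold_locales (simp_all add: shifted_def)
    moreover have "top_maximizer (- 0) < (norm (matrix_inv (shifted H 0) *v g))\<^sup>2"
      using top_maximizer_0_less not_min by (simp add: argmin_eq shifted_def)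
    ultimately obtain l where l: "l < 0"
      "(norm (matrix_inv (shifted H l) *v g))\<^sup>2 = top_maximizer (- l)"
      "\<And>m. m < 0 \<Longrightarrow> (norm (matrix_inv (shifted H m) *v g))\<^sup>2 = top_maximizer (- m) \<Longrightarrow> m = l"
      using secular_equation[OF _ order_refl assms(1)] by blast
    have "positive_definite (shifted H l)"
      using positive_definite_shifted_mono[of H 0 l] pd assms(2) l(1) by (simp add: shifted_def)
    then have "solves_P g H \<rho> (- (matrix_inv (shifted H l) *v g))"
      using solves l(2) top_maximizer by simp
    then show "\<exists>l<0. (norm (matrix_inv (shifted H l) *v g))\<^sup>2 = deriv \<phi> (- l) \<and>
        (\<forall>m<0. (norm (matrix_inv (shifted H m) *v g))\<^sup>2 = deriv \<phi> (- m) \<longrightarrow> m = l) \<and>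
        solves_P g H \<rho> (- (matrix_inv (shifted H l) *v g))"
    proof (intro exI[of _ l] conjI allI impI)
      show "(norm (matrix_inv (shifted H l) *v g))\<^sup>2 = deriv \<phi> (- l)"
        using l(1,2) deriv_conj[of "- l"] by simp
      show "m = l" if "m < 0" "(norm (matrix_inv (shifted H m) *v g))\<^sup>2 = deriv \<phi> (- m)" for m
        using l(3)[of m] that deriv_conj[of "- m"] by simp
    qed (use l(1) in simp_all)
  next
    let ?\<mu> = "lambda_min H"
    assume "?\<mu> \<le> 0 \<and> g \<in> mat_range (shifted H ?\<mu>)"
    then have \<mu>: "?\<mu> \<le> 0" and g: "g \<in> mat_range (shifted H ?\<mu>)"
      by simp_all
    obtain P where "kernel_shift H P"
      using kernel_shift_exists[OF assms(2)] by blast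
    then interpret kernel_shift H P .
    have rd: "right_deriv \<phi> (- ?\<mu>) = top_maximizer (- ?\<mu>)"
      using \<mu> by (simp add: right_deriv_conj)
    show "continuous_on {..?\<mu>} (\<lambda>l. pinv (shifted H l) *v g)"
      using continuous_on_res[of g] by (rule continuous_on_eq) (simp add: pinv_eq_res[OF g])
    show "\<exists>l<?\<mu>. (norm (matrix_inv (shifted H l) *v g))\<^sup>2 = deriv \<phi> (- l) \<and>
        (\<forall>m<?\<mu>. (norm (matrix_inv (shifted H m) *v g))\<^sup>2 = deriv \<phi> (- m) \<longrightarrow> m = l) \<and>
        solves_P g H \<rho> (- (matrix_inv (shifted H l) *v g))"
      if "sqrt (right_deriv \<phi> (- ?\<mu>)) < norm (pinv (shifted H ?\<mu>) *v g)"
    proof -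
      have "top_maximizer (- ?\<mu>) < (norm (matrix_inv (shifted (H + P) ?\<mu>) *v g))\<^sup>2"
        using that power_strict_mono[of "sqrt (top_maximizer (- ?\<mu>))" "norm (res g ?\<mu>)" 2]
        by (simp add: rd pinv_eq_res[OF g] top_maximizer_nonneg flip: res_def)
      then obtain l where l: "l < ?\<mu>" "(norm (res g l))\<^sup>2 = top_maximizer (- l)"
        "\<And>m. m < ?\<mu> \<Longrightarrow> (norm (res g m))\<^sup>2 = top_maximizer (- m) \<Longrightarrow> m = l"
        using secular_equation[OF coercive_family_axioms \<mu> assms(1)] unfolding res_def by blast
      \<comment> \<open>The equation was solved for \<open>H + P\<close>; strictly below
        \<open>\<mu>\<close> its resolvent at \<open>g\<close> agrees with that of
        \<open>H\<close>.\<close>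
      have "solves_P g H \<rho> (- (matrix_inv (shifted H l) *v g))"
        using l(1,2) top_maximizer[of "- l"] matrix_inv_eq_res[OF g]
        by (intro solves positive_definite_below) simp_all
      then show ?thesis
      proof (intro exI[of _ l] conjI allI impI)
        show "(norm (matrix_inv (shifted H l) *v g))\<^sup>2 = deriv \<phi> (- l)"
          using l(1,2) \<mu> deriv_conj[of "- l"] by (simp add: matrix_inv_eq_res[OF g])
        show "m = l" if "m < ?\<mu>" "(norm (matrix_inv (shifted H m) *v g))\<^sup>2 = deriv \<phi> (- m)" for m
          using l(3)[of m] that \<mu> deriv_conj[of "- m"] by (simp add: matrix_inv_eq_res[OF g])
      qed (use l(1) in simp_all)
    qed
    show "\<exists>\<alpha> v. v \<in> mat_ker (shifted H ?\<mu>) - {0} \<and>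
        right_deriv \<phi> (- ?\<mu>) = (norm (pinv (shifted H ?\<mu>) *v g - \<alpha> *\<^sub>R v))\<^sup>2 \<and>
        solves_P g H \<rho> (- (pinv (shifted H ?\<mu>) *v g) + \<alpha> *\<^sub>R v)"
      if le: "norm (pinv (shifted H ?\<mu>) *v g) \<le> sqrt (right_deriv \<phi> (- ?\<mu>))"
    proof -
      define p where "p = pinv (shifted H ?\<mu>) *v g"
      have p: "p = res g ?\<mu>"
        by (simp add: p_def pinv_eq_res[OF g])
      obtain w where w: "w \<noteq> 0" "H *v w = ?\<mu> *\<^sub>R w"
        using lambda_min_eigenvalue[OF assms(2)] by (auto simp: eigenvalues_def)
      define v where "v = w /\<^sub>R norm w"
      have v: "norm v = 1" "v \<in> mat_ker (shifted H ?\<mu>)"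
        using w by (simp_all add: v_def mat_ker_def shifted_vmult matrix_vector_mult_scaleR)
      have "v \<bullet> p = 0"
        using res_orthogonal_ker[OF g _ v(2)] by (simp add: p)
      \<comment> \<open>Pythagoras: \<open>p\<close> is orthogonal to the unit kernel vector
        \<open>v\<close>.\<close>
      then have norm: "(norm (p - \<alpha> *\<^sub>R v))\<^sup>2 = (norm p)\<^sup>2 + \<alpha>\<^sup>2" for \<alpha>
        using v(1) unfolding power2_norm_eq_inner
        by (simp add: inner_diff inner_commute norm_eq_1 power2_eq_square)
      \<comment> \<open>\<open>\<alpha>\<close> supplies the missing squared norm; the case
        hypothesis makes the radicand nonnegative. It may be \<open>0\<close>, while
        \<open>v\<close> is nonzero in any case.\<close>
      define \<alpha> where "\<alpha> = sqrt (top_maximizer (- ?\<mu>) - (norm p)\<^sup>2)"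
      have "(norm p)\<^sup>2 \<le> top_maximizer (- ?\<mu>)"
        using le power_mono[of "norm p" "sqrt (top_maximizer (- ?\<mu>))" 2]
        by (simp add: rd p_def top_maximizer_nonneg)
      then have eq: "(norm (p - \<alpha> *\<^sub>R v))\<^sup>2 = top_maximizer (- ?\<mu>)"
        by (simp add: norm \<alpha>_def)
      have "solves_P g H \<rho> (- p + \<alpha> *\<^sub>R v)"
      proof (rule solves_P_if_maximizer[OF assms(2) psd])
        show "shifted H ?\<mu> *v (- p + \<alpha> *\<^sub>R v) = - g"
          using shifted_H_res[OF g order_refl] v(2) matrix_vector_mult_diff_distrib[of "shifted H ?\<mu>" "\<alpha> *\<^sub>R v" p]
          by (simp add: p mat_ker_def matrix_vector_mult_scaleR)
        have "norm (- p + \<alpha> *\<^sub>R v) = norm (p - \<alpha> *\<^sub>R v)"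
          by (metis add.commute norm_minus_commute uminus_add_conv_diff)
        then show "maximizer (- ?\<mu>) ((norm (- p + \<alpha> *\<^sub>R v))\<^sup>2)"
          using eq top_maximizer by simp
      qed
      moreover have "v \<noteq> 0"
        using v(1) by auto
      ultimately show ?thesis
        unfolding p_def[symmetric] using eq v(2) rd by (intro exI[of _ \<alpha>] exI[of _ v]) simp
    qed
  qed
qed

end
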